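(* Let $p\ge 1$, let $\boldsymbol{\Sigma}\in\mathbb{R}^{p\times p}$ be a (positive definite) covariance matrix with precision matrix $\boldsymbol{\Omega}=\boldsymbol{\Sigma}^{-1}$, and suppose $\boldsymbol{\Omega}\in\mathcal{U}_q(s_p,M_p)$ for some $0\le q<1$. Let $\widehat{\boldsymbol{\Sigma}}\in\mathbb{R}^{p\times p}$ be an arbitrary (symmetric) estimator of $\boldsymbol{\Sigma}$, and let $\lambda\ge 0$ satisfy $$\lambda\ \ge\ 3\|\boldsymbol{\Omega}\|_{L_1}\|\widehat{\boldsymbol{\Sigma}}-\boldsymbol{\Sigma}\|_\infty\qquad\text{and}\qquad \|\boldsymbol{\Omega}\|_{L_1}^{-q}\lambda^{1-q}s_p\ \le\ \tfrac12 .$$ Let $\boldsymbol{e}$ be any column of the $p\times p$ identity matrix, let $\boldsymbol{\beta}^*=\boldsymbol{\Omega}\boldsymbol{e}$ be the corresponding column of $\boldsymbol{\Omega}$, and let $\widehat{\boldsymbol{\beta}}$ be the SCIO estimator, i.e. a minimizer $$\widehat{\boldsymbol{\beta}}\in\operatorname*{arg\,min}_{\boldsymbol{\beta}\in\mathbb{R}^p}\Big\{\tfrac12\boldsymbol{\beta}^{T}\widehat{\boldsymbol{\Sigma}}\boldsymbol{\beta}-\boldsymbol{e}^{T}\boldsymbol{\beta}+\lambda|\boldsymbol{\beta}|_1\Big\}.$$ Then $$|\widehat{\boldsymbol{\beta}}-\boldsymbol{\beta}^*|_1\le 16\,\|\boldsymbol{\Omega}\|_{L_1}^{1-q}\,s_p\,\lambda^{1-q},\qquad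 |\widehat{\boldsymbol{\beta}}-\boldsymbol{\beta}^*|_\infty\le 4\,\|\boldsymbol{\Omega}\|_{L_1}\,\lambda .$$
   Context: For a vector $\mathbf{a}=(a_1,\dots,a_p)^T$: $|\mathbf{a}|_1=\sum_i|a_i|$ and $|\mathbf{a}|_\infty=\max_i|a_i|$. For a matrix $\mathbf{A}=(a_{ij})$: $\|\mathbf{A}\|_\infty=\max_{i,j}|a_{ij}|$ (element-wise maximum) and $\|\mathbf{A}\|_{L_1}=\max_j\sum_i|a_{ij}|$ (maximum absolute column sum). For $0\le q<1$, the weakly sparse class is $$\mathcal{U}_q(s_p,M_p)=\Big\{\boldsymbol{\Omega}=(\omega_{ij})_{p\times p}:\ \boldsymbol{\Omega}\succ 0,\ \max_{1\le j\le p}\sum_{i=1}^p|\omega_{ij}|^q\le s_p,\ \|\boldsymbol{\Omega}\|_{L_1}\le M_p\Big\},$$ where $\boldsymbol{\Omega}\succ0$ means symmetric positive definite, $s_p,M_p>0$, and for $q=0$ the convention is $|x|^0=1$ if $x\ne0$ and $|0|^0=0$ (number of nonzero entries). *)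

theory Defs
  imports "HOL-Analysis.Analysis"
begin

definition vec_norm1 :: "real ^ 'p \<Rightarrow> real" where
  "vec_norm1 a = (\<Sum>i\<in>UNIV. \<bar>a $ i\<bar>)"

definition vec_norm_inf :: "real ^ 'p \<Rightarrow> real" where
  "vec_norm_inf a = (MAX i. \<bar>a $ i\<bar>)"

(* Largest absolute entry, not the operator norm induced by vec_norm_inf. *)
definition mat_norm_inf :: "real ^ 'p ^ 'p \<Rightarrow> real" where
  "mat_norm_inf A = Max {\<bar>A $ i $ j\<bar> | i j. True}"

definition mat_norm_L1 :: "real ^ 'p ^ 'p \<Rightarrow> real" where
  "mat_norm_L1 A = (MAX j. \<Sum>i\<in>UNIV. \<bar>A $ i $ j\<bar>)"

definition symmetric_mat :: "real ^ 'p ^ 'p \<Rightarrow> bool" where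
  "symmetric_mat A \<longleftrightarrow> transpose A = A"

definition pos_def_mat :: "real ^ 'p ^ 'p \<Rightarrow> bool" where
  "pos_def_mat A \<longleftrightarrow> symmetric_mat A \<and> (\<forall>x. x \<noteq> 0 \<longrightarrow> x \<bullet> (A *v x) > 0)"

(* Since 0 powr 0 = 0 and x powr 0 = 1 for x > 0, for q = 0 the powr sum
   counts the nonzero entries of column j. *)
definition weakly_sparse_class :: "real \<Rightarrow> real \<Rightarrow> real \<Rightarrow> (real ^ 'p ^ 'p) set" where
  "weakly_sparse_class q s M =
     {A. pos_def_mat A \<and> (MAX j. \<Sum>i\<in>UNIV. \<bar>A $ i $ j\<bar> powr q) \<le> s \<and> mat_norm_L1 A \<le> M}"

definition scio_objective :: "real ^ 'p ^ 'p \<Rightarrow> real ^ 'p \<Rightarrow> real \<Rightarrow> real ^ 'p \<Rightarrow> real" where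
  "scio_objective S e lam \<beta> = 1 / 2 * (\<beta> \<bullet> (S *v \<beta>)) - e \<bullet> \<beta> + lam * vec_norm1 \<beta>"

end

theory Submission
  imports Defs
begin

text \<open>
  Write \<open>\<delta>\<close> for the estimation error and \<open>L\<close> for the \<open>L\<^sub>1\<close> norm of \<open>\<Omega>\<close>. The mere existence of a
  minimizer forces the estimator of \<open>\<Sigma>\<close> to be positive semidefinite, so comparing the objective at
  the minimizer and at the target gives the cone condition
  \<open>|\<delta>|\<^sub>1 \<le> 3 |\<delta>\<^sub>J|\<^sub>1 + 3 |\<beta>\<^sub>J\<^sub>c|\<^sub>1\<close> for every index set \<open>J\<close>, where \<open>J\<^sub>c\<close> is its complement. Taking
  for \<open>J\<close> the coordinates of the target exceeding \<open>t = L \<lambda>\<close>, weak sparsity gives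
  \<open>|J| \<le> n\<close> and \<open>|\<beta>\<^sub>J\<^sub>c|\<^sub>1 \<le> n t\<close> with \<open>n = s t\<^sup>-\<^sup>q\<close>, hence \<open>|\<delta>|\<^sub>1 \<le> 3 n (|\<delta>|\<^sub>\<infinity> + t)\<close>.
  The coordinatewise optimality conditions give \<open>|\<delta>|\<^sub>\<infinity> \<le> (4/3) t + (\<lambda>/3) |\<delta>|\<^sub>1\<close>. As
  \<open>\<lambda> n \<le> 1/2\<close>, solving the two inequalities yields \<open>|\<delta>|\<^sub>\<infinity> \<le> (11/3) t\<close> and \<open>|\<delta>|\<^sub>1 \<le> 14 n t\<close>.
\<close>

section \<open>Norm inequalities\<close>

lemma vec_norm1_nonneg: "0 \<le> vec_norm1 x"
  unfolding vec_norm1_def by (simp add: sum_nonneg)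

lemma abs_nth_le_vec_norm_inf: "\<bar>x $ i\<bar> \<le> vec_norm_inf x"
  unfolding vec_norm_inf_def by (rule Max_ge) auto

lemma vec_norm_inf_le_iff: "vec_norm_inf x \<le> c \<longleftrightarrow> (\<forall>i. \<bar>x $ i\<bar> \<le> c)"
  unfolding vec_norm_inf_def by (subst Max_le_iff) auto

lemma vec_norm_inf_nonneg: "0 \<le> vec_norm_inf x"
  using abs_nth_le_vec_norm_inf[of x undefined] by linarith

lemma vec_norm_inf_minus_le: "vec_norm_inf (x - y) \<le> vec_norm_inf x + vec_norm_inf y"
proof -
  have "\<bar>(x - y) $ i\<bar> \<le> vec_norm_inf x + vec_norm_inf y" for i
    using abs_nth_le_vec_norm_inf[of x i] abs_nth_le_vec_norm_inf[of y i] by simp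
  then show ?thesis unfolding vec_norm_inf_le_iff by blast
qed

lemma abs_inner_le_norm1_norm_inf: "\<bar>x \<bullet> y\<bar> \<le> vec_norm1 x * vec_norm_inf y"
proof -
  have "\<bar>x \<bullet> y\<bar> \<le> (\<Sum>i\<in>UNIV. \<bar>x $ i * y $ i\<bar>)"
    unfolding inner_vec_def by (simp add: sum_abs)
  also have "\<dots> \<le> (\<Sum>i\<in>UNIV. \<bar>x $ i\<bar> * vec_norm_inf y)"
    by (intro sum_mono) (simp add: abs_mult abs_nth_le_vec_norm_inf mult_left_mono)
  finally show ?thesis by (simp add: vec_norm1_def sum_distrib_right)
qed

lemma abs_entry_le_mat_norm_inf: "\<bar>A $ i $ j\<bar> \<le> mat_norm_inf A"
proof -
  have "{\<bar>A $ i $ j\<bar> | i j. True} = (\<lambda>(i, j). \<bar>A $ i $ j\<bar>) ` UNIV"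
    by auto
  then have "finite {\<bar>A $ i $ j\<bar> | i j. True}"
    by simp
  then show ?thesis
    unfolding mat_norm_inf_def by (rule Max_ge) auto
qed

lemma mat_norm_inf_nonneg: "0 \<le> mat_norm_inf A"
  using abs_entry_le_mat_norm_inf[of A undefined undefined] by linarith

lemma column_sum_le_mat_norm_L1: "(\<Sum>i\<in>UNIV. \<bar>A $ i $ j\<bar>) \<le> mat_norm_L1 A"
  unfolding mat_norm_L1_def by (rule Max_ge) auto

lemma vec_norm_inf_mult_vec_le: "vec_norm_inf (A *v x) \<le> mat_norm_inf A * vec_norm1 x"
proof -
  have "\<bar>(A *v x) $ i\<bar> \<le> mat_norm_inf A * vec_norm1 x" for i
  proof -
    have "\<bar>(A *v x) $ i\<bar> \<le> (\<Sum>j\<in>UNIV. \<bar>A $ i $ j * x $ j\<bar>)"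
      by (simp add: matrix_vector_mult_def sum_abs)
    also have "\<dots> \<le> (\<Sum>j\<in>UNIV. mat_norm_inf A * \<bar>x $ j\<bar>)"
      by (intro sum_mono) (simp add: abs_mult abs_entry_le_mat_norm_inf mult_right_mono)
    finally show ?thesis by (simp add: vec_norm1_def sum_distrib_left)
  qed
  then show ?thesis unfolding vec_norm_inf_le_iff by blast
qed

text \<open>The operator norm induced by \<open>vec_norm_inf\<close> is the largest absolute row
  sum; symmetry turns rows into columns.\<close>

lemma vec_norm_inf_symmetric_mult_vec_le:
  assumes "symmetric_mat A"
  shows "vec_norm_inf (A *v x) \<le> mat_norm_L1 A * vec_norm_inf x"
proof -
  have sym: "A $ i $ j = A $ j $ i" for i j
    using assms unfolding symmetric_mat_def by (metis transpose_def vec_lambda_beta)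
  have "\<bar>(A *v x) $ i\<bar> \<le> mat_norm_L1 A * vec_norm_inf x" for i
  proof -
    have "\<bar>(A *v x) $ i\<bar> \<le> (\<Sum>j\<in>UNIV. \<bar>A $ i $ j * x $ j\<bar>)"
      by (simp add: matrix_vector_mult_def sum_abs)
    also have "\<dots> \<le> (\<Sum>j\<in>UNIV. \<bar>A $ j $ i\<bar> * vec_norm_inf x)"
      by (intro sum_mono) (simp add: abs_mult sym[of i] abs_nth_le_vec_norm_inf mult_left_mono)
    also have "\<dots> \<le> mat_norm_L1 A * vec_norm_inf x"
      unfolding sum_distrib_right[symmetric]
      by (intro mult_right_mono column_sum_le_mat_norm_L1 vec_norm_inf_nonneg)
    finally show ?thesis .
  qed
  then show ?thesis unfolding vec_norm_inf_le_iff by blast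
qed

section \<open>Symmetric and positive definite matrices\<close>

lemma symmetric_mat_inner_commute:
  assumes "symmetric_mat A"
  shows "x \<bullet> (A *v y) = y \<bullet> (A *v x)"
  using assms unfolding symmetric_mat_def by (metis dot_lmul_matrix inner_commute vector_transpose_matrix)

text \<open>Each diagonal entry is the quadratic form at a basis vector, hence positive, and its
  column sum dominates it.\<close>

lemma pos_def_mat_L1_pos:
  fixes A :: "real ^ 'n ^ 'n"
  assumes "pos_def_mat A"
  shows "0 < mat_norm_L1 A"
proof -
  fix k :: 'n
  have "axis k (1::real) \<noteq> 0"
    by (simp add: axis_eq_0_iff)
  then have "0 < axis k 1 \<bullet> (A *v axis k 1)"
    using assms unfolding pos_def_mat_def by blast
  then have "0 < A $ k $ k"
    by (simp add: inner_axis' matrix_vector_mult_basis column_def)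
  also have "A $ k $ k \<le> (\<Sum>i\<in>UNIV. \<bar>A $ i $ k\<bar>)"
    by (rule order_trans[OF abs_ge_self])
      (use member_le_sum[of k UNIV "\<lambda>i. \<bar>A $ i $ k\<bar>"] in simp)
  finally show ?thesis
    using column_sum_le_mat_norm_L1[of A k] by linarith
qed

lemma pos_def_mat_invertible:
  assumes "pos_def_mat A"
  shows "invertible A"
proof -
  have "x = 0" if "A *v x = 0" for x
    using assms that unfolding pos_def_mat_def by (metis inner_zero_right less_irrefl)
  then show ?thesis
    by (metis invertible_left_inverse matrix_left_invertible_ker)
qed

section \<open>The objective and its minimizers\<close>

lemma scio_objective_diff:
  assumes "symmetric_mat S"
  shows "scio_objective S e lam (\<beta> + d) - scio_objective S e lam \<beta> =
    d \<bullet> (S *v \<beta> - e) + 1 / 2 * (d \<bullet> (S *v d)) + lam * (vec_norm1 (\<beta> + d) - vec_norm1 \<beta>)"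
  \<comment> \<open>Symmetry merges the two cross terms into one gradient term.\<close>
  using symmetric_mat_inner_commute[OF assms, of \<beta> d]
  by (simp add: scio_objective_def matrix_vector_right_distrib inner_add_left inner_add_right
      inner_diff_right inner_commute[of e] algebra_simps)

lemma bounded_below_quadratic_leading_nonneg:
  fixes a b m :: real
  assumes "\<And>t. 0 \<le> t \<Longrightarrow> m \<le> a * t\<^sup>2 + b * t"
  shows "0 \<le> a"
proof (rule ccontr)
  assume "\<not> 0 \<le> a"
  then have a: "a < 0" by simp
  \<comment> \<open>The quotient outweighs \<open>b\<close> and \<open>m\<close> in
    \<open>a * t + b\<close>; the final 1 gives \<open>t \<ge> 1\<close>, so that multiplying a
    negative value by \<open>t\<close> only lowers it.\<close>
  define t where "t = (\<bar>b\<bar> + \<bar>m\<bar> + 1) / (- a) + 1"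
  have t: "1 \<le> t" using a by (simp add: t_def divide_nonneg_nonpos)
  have "a * t = - (\<bar>b\<bar> + \<bar>m\<bar> + 1) + a" using a by (simp add: t_def field_simps)
  then have "a * t + b \<le> - \<bar>m\<bar> - 1" using a by linarith
  then have "(a * t + b) * t \<le> (- \<bar>m\<bar> - 1) * t" using t by (intro mult_right_mono) auto
  also have "\<dots> \<le> (- \<bar>m\<bar> - 1) * 1" using t by (intro mult_left_mono_neg) auto
  also have "\<dots> < m" using abs_ge_minus_self[of m] by simp
  finally show False using assms[of t] t by (simp add: power2_eq_square algebra_simps)
qed

text \<open>Along a ray from the origin the l1 term is linear, so the objective is a quadratic in
  \<open>t\<close> whose leading coefficient is half the form at \<open>d\<close>; a minimizer
  bounds it below.\<close>

lemma scio_minimizer_imp_psd: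
  assumes "is_arg_min (scio_objective S e lam) (\<lambda>_. True) \<beta>"
  shows "0 \<le> d \<bullet> (S *v d)"
proof -
  have "scio_objective S e lam \<beta> \<le> (1 / 2 * (d \<bullet> (S *v d))) * t\<^sup>2 + (lam * vec_norm1 d - e \<bullet> d) * t"
    if "0 \<le> t" for t
  proof -
    have "vec_norm1 (t *\<^sub>R d) = t * vec_norm1 d"
      using that by (simp add: vec_norm1_def abs_mult sum_distrib_left)
    then have "scio_objective S e lam (t *\<^sub>R d)
        = (1 / 2 * (d \<bullet> (S *v d))) * t\<^sup>2 + (lam * vec_norm1 d - e \<bullet> d) * t"
      by (simp add: scio_objective_def matrix_vector_mult_scaleR power2_eq_square algebra_simps)
    then show ?thesis
      using assms by (metis is_arg_min_linorder)
  qed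
  from bounded_below_quadratic_leading_nonneg[OF this] show ?thesis by simp
qed

text \<open>Near 0 the quadratic term is negligible, so a slope steeper than the kink would make one
  side negative.\<close>

lemma abs_slope_le_of_kink_minimum:
  fixes g a lam :: real
  assumes "\<And>t. 0 \<le> t * g + t\<^sup>2 * a + lam * \<bar>t\<bar>"
  shows "\<bar>g\<bar> \<le> lam"
proof (rule ccontr)
  assume "\<not> \<bar>g\<bar> \<le> lam"
  then have gap: "0 < \<bar>g\<bar> - lam" by simp
  \<comment> \<open>Small enough that \<open>r * \<bar>a\<bar>\<close> stays below the gap; adding 1
    makes this strict and the denominator positive.\<close>
  define r where "r = (\<bar>g\<bar> - lam) / (\<bar>a\<bar> + 1)"
  have r: "0 < r" using gap by (simp add: r_def)
  have "r * \<bar>a\<bar> < r * (\<bar>a\<bar> + 1)" using r by simp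
  also have "\<dots> = \<bar>g\<bar> - lam" by (simp add: r_def add_nonneg_eq_0_iff)
  finally have "r * (r * \<bar>a\<bar>) < r * (\<bar>g\<bar> - lam)" using r by simp
  moreover have "r\<^sup>2 * a \<le> r * (r * \<bar>a\<bar>)"
    by (simp add: power2_eq_square mult.assoc[symmetric] mult_left_mono)
  \<comment> \<open>Move against the sign of \<open>g\<close>.\<close>
  moreover have "0 \<le> - (r * \<bar>g\<bar>) + r\<^sup>2 * a + lam * r"
    using assms[of r] assms[of "- r"] r by (cases "0 \<le> g") simp_all
  ultimately show False by (simp add: algebra_simps)
qed

text \<open>Moving one coordinate by \<open>t\<close> raises the l1 norm by at most
  \<open>\<bar>t\<bar>\<close>, so minimality reduces to a one-dimensional kink.\<close>

lemma scio_minimizer_gradient_le: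
  assumes "symmetric_mat S" and "is_arg_min (scio_objective S e lam) (\<lambda>_. True) \<beta>"
    and "0 \<le> lam"
  shows "vec_norm_inf (S *v \<beta> - e) \<le> lam"
proof -
  have "\<bar>(S *v \<beta> - e) $ i\<bar> \<le> lam" for i
  proof -
    let ?u = "axis i (1::real)"
    have "0 \<le> t * (S *v \<beta> - e) $ i + t\<^sup>2 * (1 / 2 * (?u \<bullet> (S *v ?u))) + lam * \<bar>t\<bar>" for t
    proof -
      have "vec_norm1 (\<beta> + t *\<^sub>R ?u) \<le> (\<Sum>j\<in>UNIV. \<bar>\<beta> $ j\<bar> + (if j = i then \<bar>t\<bar> else 0))"
        unfolding vec_norm1_def by (intro sum_mono) (simp add: axis_def abs_triangle_ineq)
      then have "vec_norm1 (\<beta> + t *\<^sub>R ?u) - vec_norm1 \<beta> \<le> \<bar>t\<bar>"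
        by (simp add: vec_norm1_def sum.distrib)
      then have "lam * (vec_norm1 (\<beta> + t *\<^sub>R ?u) - vec_norm1 \<beta>) \<le> lam * \<bar>t\<bar>"
        using assms(3) by (rule mult_left_mono)
      moreover have "0 \<le> scio_objective S e lam (\<beta> + t *\<^sub>R ?u) - scio_objective S e lam \<beta>"
        using assms(2) by (simp add: is_arg_min_linorder)
      ultimately show ?thesis
        unfolding scio_objective_diff[OF assms(1)]
        by (simp add: inner_axis' matrix_vector_mult_scaleR power2_eq_square algebra_simps)
    qed
    then show ?thesis by (rule abs_slope_le_of_kink_minimum)
  qed
  then show ?thesis unfolding vec_norm_inf_le_iff by blast
qed

text \<open>In the expansion at \<open>b\<close> the quadratic remainder is nonnegative and drops
  out; Hoelder's inequality bounds the gradient term.\<close>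

lemma scio_minimizer_norm1_le:
  assumes "symmetric_mat S" and "is_arg_min (scio_objective S e lam) (\<lambda>_. True) \<beta>"
  shows "lam * (vec_norm1 \<beta> - vec_norm1 b) \<le> vec_norm1 (\<beta> - b) * vec_norm_inf (S *v b - e)"
proof -
  have "scio_objective S e lam (b + (\<beta> - b)) - scio_objective S e lam b \<le> 0"
    using assms(2) by (simp add: is_arg_min_linorder)
  then have "(\<beta> - b) \<bullet> (S *v b - e) + lam * (vec_norm1 \<beta> - vec_norm1 b) \<le> 0"
    unfolding scio_objective_diff[OF assms(1)]
    using scio_minimizer_imp_psd[OF assms(2), of "\<beta> - b"] by simp
  then show ?thesis
    using abs_inner_le_norm1_norm_inf[of "\<beta> - b" "S *v b - e"] by linarith
qed

section \<open>Cone condition and weak sparsity\<close>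

lemma norm1_cone:
  assumes "3 * (vec_norm1 (b + d) - vec_norm1 b) \<le> vec_norm1 d"
  shows "vec_norm1 d \<le> 3 * (\<Sum>i\<in>J. \<bar>d $ i\<bar>) + 3 * (\<Sum>i\<in>-J. \<bar>b $ i\<bar>)"
proof -
  have split: "vec_norm1 x = (\<Sum>i\<in>J. \<bar>x $ i\<bar>) + (\<Sum>i\<in>-J. \<bar>x $ i\<bar>)" for x :: "real ^ 'a"
    unfolding vec_norm1_def
    using sum.union_disjoint[of J "-J" "\<lambda>i. \<bar>x $ i\<bar>"] by (simp add: Compl_partition)
  \<comment> \<open>Opposite reverse triangle inequalities on \<open>J\<close> and off
    \<open>J\<close>. With the assumption they bound the tail of \<open>d\<close> by twice its part
    on \<open>J\<close> plus three times the tail of \<open>b\<close>.\<close>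
  have "(\<Sum>i\<in>J. \<bar>b $ i\<bar> - \<bar>d $ i\<bar>) \<le> (\<Sum>i\<in>J. \<bar>(b + d) $ i\<bar>)"
    by (intro sum_mono) (simp add: abs_if)
  moreover have "(\<Sum>i\<in>-J. \<bar>d $ i\<bar> - \<bar>b $ i\<bar>) \<le> (\<Sum>i\<in>-J. \<bar>(b + d) $ i\<bar>)"
    by (intro sum_mono) (simp add: abs_if)
  ultimately show ?thesis
    using assms split[of b] split[of d] split[of "b + d"] by (simp add: sum_subtractf)
qed

text \<open>Markov's inequality: each counted coordinate contributes at least
  \<open>t powr q\<close>.\<close>

lemma card_above_threshold_le:
  fixes x :: "real ^ 'n"
  assumes "0 < t" "0 \<le> q" "(\<Sum>i\<in>UNIV. \<bar>x $ i\<bar> powr q) \<le> s"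
  shows "real (card {i. t < \<bar>x $ i\<bar>}) \<le> s * t powr (- q)"
proof -
  let ?J = "{i. t < \<bar>x $ i\<bar>}"
  have "real (card ?J) * t powr q = (\<Sum>i\<in>?J. t powr q)"
    by simp
  also have "\<dots> \<le> (\<Sum>i\<in>?J. \<bar>x $ i\<bar> powr q)"
    using assms by (intro sum_mono powr_mono2) auto
  also have "\<dots> \<le> s"
    using sum_mono2[of UNIV ?J "\<lambda>i. \<bar>x $ i\<bar> powr q"] assms(3) by simp
  finally show ?thesis
    using assms(1) by (simp add: powr_minus field_simps)
qed

text \<open>Factor out \<open>\<bar>x $ i\<bar> powr q\<close>; below the threshold the other factor
  is at most \<open>t powr (1 - q)\<close>, as \<open>1 - q\<close> is positive.\<close>

lemma sum_below_threshold_le: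
  fixes x :: "real ^ 'n"
  assumes "0 < t" "q < 1" "(\<Sum>i\<in>UNIV. \<bar>x $ i\<bar> powr q) \<le> s"
  shows "(\<Sum>i\<in>-{i. t < \<bar>x $ i\<bar>}. \<bar>x $ i\<bar>) \<le> s * t powr (1 - q)"
proof -
  let ?J = "{i. t < \<bar>x $ i\<bar>}"
  have "\<bar>x $ i\<bar> \<le> \<bar>x $ i\<bar> powr q * t powr (1 - q)" if "i \<in> -?J" for i
  proof -
    have "\<bar>x $ i\<bar> = \<bar>x $ i\<bar> powr q * \<bar>x $ i\<bar> powr (1 - q)"
      by (simp flip: powr_add)
    also have "\<dots> \<le> \<bar>x $ i\<bar> powr q * t powr (1 - q)"
      using that assms by (intro mult_left_mono powr_mono2) auto
    finally show ?thesis .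
  qed
  then have "(\<Sum>i\<in>-?J. \<bar>x $ i\<bar>) \<le> (\<Sum>i\<in>-?J. \<bar>x $ i\<bar> powr q) * t powr (1 - q)"
    unfolding sum_distrib_right by (rule sum_mono)
  also have "\<dots> \<le> s * t powr (1 - q)"
    using sum_mono2[of UNIV "-?J" "\<lambda>i. \<bar>x $ i\<bar> powr q"] assms(3)
    by (intro mult_right_mono) auto
  finally show ?thesis .
qed

lemma norm1_le_of_cone_sparse:
  fixes b d :: "real ^ 'n"
  assumes "3 * (vec_norm1 (b + d) - vec_norm1 b) \<le> vec_norm1 d"
    and "0 < t" "0 \<le> q" "q < 1" "(\<Sum>i\<in>UNIV. \<bar>b $ i\<bar> powr q) \<le> s"
  shows "vec_norm1 d \<le> 3 * (s * t powr (- q)) * (vec_norm_inf d + t)"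
proof -
  let ?J = "{i. t < \<bar>b $ i\<bar>}"
  have "(\<Sum>i\<in>?J. \<bar>d $ i\<bar>) \<le> real (card ?J) * vec_norm_inf d"
    by (intro sum_bounded_above abs_nth_le_vec_norm_inf)
  also have "\<dots> \<le> s * t powr (- q) * vec_norm_inf d"
    using card_above_threshold_le[of t q b s] assms by (intro mult_right_mono vec_norm_inf_nonneg)
  finally have "(\<Sum>i\<in>?J. \<bar>d $ i\<bar>) \<le> s * t powr (- q) * vec_norm_inf d" .
  \<comment> \<open>Writing \<open>t powr (1 - q)\<close> as \<open>t powr (- q) * t\<close> gives
    both parts the same factor.\<close>
  moreover have "(\<Sum>i\<in>-?J. \<bar>b $ i\<bar>) \<le> s * t powr (- q) * t"
    using sum_below_threshold_le[of t q b s] assms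
    by (simp add: powr_diff powr_minus divide_inverse mult_ac)
  ultimately show ?thesis
    using norm1_cone[OF assms(1), of ?J] by (simp add: algebra_simps)
qed

section \<open>The error bounds\<close>

theorem theorem1:
  fixes \<Sigma> \<Omega> \<Sigma>_hat :: "real ^ 'p ^ 'p"
    and e \<beta>_star \<beta>_hat :: "real ^ 'p"
    and q s M lam :: real
    and k :: 'p
  assumes Sigma: "pos_def_mat \<Sigma>"
    and Omega: "\<Omega> = matrix_inv \<Sigma>"
    and q: "0 \<le> q" "q < 1"
    and sM: "s > 0" "M > 0"
    and sparse: "\<Omega> \<in> weakly_sparse_class q s M"
    and Sigma_hat: "symmetric_mat \<Sigma>_hat"
    and lambda: "lam \<ge> 0"
      "lam \<ge> 3 * mat_norm_L1 \<Omega> * mat_norm_inf (\<Sigma>_hat - \<Sigma>)"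
      "mat_norm_L1 \<Omega> powr (-q) * lam powr (1 - q) * s \<le> 1 / 2"
    and e: "e = column k (mat 1)"
    and beta_star: "\<beta>_star = \<Omega> *v e"
    and beta_hat: "is_arg_min (scio_objective \<Sigma>_hat e lam) (\<lambda>_. True) \<beta>_hat"
  shows "vec_norm1 (\<beta>_hat - \<beta>_star) \<le> 16 * mat_norm_L1 \<Omega> powr (1 - q) * s * lam powr (1 - q) \<and>
         vec_norm_inf (\<beta>_hat - \<beta>_star) \<le> 4 * mat_norm_L1 \<Omega> * lam"
proof -
  let ?L = "mat_norm_L1 \<Omega>"
  define D where "D = \<Sigma>_hat - \<Sigma>"
  define \<delta> where "\<delta> = \<beta>_hat - \<beta>_star"
  have Omega_pd: "pos_def_mat \<Omega>"
    and sparse_Max: "(MAX j. \<Sum>i\<in>UNIV. \<bar>\<Omega> $ i $ j\<bar> powr q) \<le> s"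
    using sparse unfolding weakly_sparse_class_def by auto
  have L: "0 < ?L"
    using Omega_pd by (rule pos_def_mat_L1_pos)
  \<comment> \<open>\<open>matrix_inv\<close> is a choice term, so both equations come from
    invertibility.\<close>
  have inv: "\<Sigma> ** \<Omega> = mat 1" "\<Omega> ** \<Sigma> = mat 1"
    using someI_ex[OF pos_def_mat_invertible[OF Sigma, unfolded invertible_def]]
    unfolding Omega matrix_inv_def by auto
  have "e = axis k 1"
    unfolding e by (simp add: vec_eq_iff column_def mat_def axis_def)
  then have star: "\<beta>_star $ i = \<Omega> $ i $ k" for i
    by (simp add: beta_star matrix_vector_mult_basis column_def)
  have Sigma_star: "\<Sigma> *v \<beta>_star = e"
    by (simp add: beta_star matrix_vector_mul_assoc inv)
  have "(\<Sum>i\<in>UNIV. \<bar>\<Omega> $ i $ k\<bar> powr q) \<le> (MAX j. \<Sum>i\<in>UNIV. \<bar>\<Omega> $ i $ j\<bar> powr q)"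
    by (rule Max_ge) auto
  with sparse_Max have star_sparse: "(\<Sum>i\<in>UNIV. \<bar>\<beta>_star $ i\<bar> powr q) \<le> s"
    by (simp add: star)
  have star_L1: "vec_norm1 \<beta>_star \<le> ?L"
    using column_sum_le_mat_norm_L1[of \<Omega> k] by (simp add: vec_norm1_def star)
  have D: "?L * mat_norm_inf D \<le> lam / 3"
    using lambda(2) by (simp add: D_def)

  \<comment> \<open>Since \<open>\<Sigma>\<close> maps the target to \<open>e\<close>, the gradient
    there is pure estimation error; the factor 3 in the bound on \<open>lam\<close> yields
    \<open>lam / 3\<close>.\<close>
  have "\<Sigma>_hat *v \<beta>_star - e = D *v \<beta>_star"
    by (simp add: D_def matrix_vector_mult_diff_rdistrib Sigma_star)
  then have "vec_norm_inf (\<Sigma>_hat *v \<beta>_star - e) \<le> mat_norm_inf D * vec_norm1 \<beta>_star"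
    by (simp add: vec_norm_inf_mult_vec_le)
  also have "\<dots> \<le> mat_norm_inf D * ?L"
    by (intro mult_left_mono star_L1 mat_norm_inf_nonneg)
  finally have grad_star: "vec_norm_inf (\<Sigma>_hat *v \<beta>_star - e) \<le> lam / 3"
    using D by (simp add: mult.commute)
  have grad_hat: "vec_norm_inf (\<Sigma>_hat *v \<beta>_hat - e) \<le> lam"
    by (rule scio_minimizer_gradient_le[OF Sigma_hat beta_hat lambda(1)])

  \<comment> \<open>The two gradients contribute \<open>lam\<close> and \<open>lam / 3\<close>,
    whence 4/3.\<close>
  have "\<Sigma> *v \<delta> = (\<Sigma>_hat *v \<beta>_hat - e) - (\<Sigma>_hat *v \<beta>_star - e) - D *v \<delta>"
    by (simp add: D_def \<delta>_def matrix_vector_mult_diff_rdistrib matrix_vector_mult_diff_distrib)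
  then have "vec_norm_inf (\<Sigma> *v \<delta>) \<le> vec_norm_inf (\<Sigma>_hat *v \<beta>_hat - e)
      + vec_norm_inf (\<Sigma>_hat *v \<beta>_star - e) + vec_norm_inf (D *v \<delta>)"
    by (metis vec_norm_inf_minus_le add_right_mono order_trans)
  then have Sigma_delta: "vec_norm_inf (\<Sigma> *v \<delta>) \<le> 4 / 3 * lam + mat_norm_inf D * vec_norm1 \<delta>"
    using grad_hat grad_star vec_norm_inf_mult_vec_le[of D \<delta>] by linarith
  have "\<delta> = \<Omega> *v (\<Sigma> *v \<delta>)"
    by (simp add: matrix_vector_mul_assoc inv)
  then have "vec_norm_inf \<delta> \<le> ?L * vec_norm_inf (\<Sigma> *v \<delta>)"
    using Omega_pd unfolding pos_def_mat_def by (metis vec_norm_inf_symmetric_mult_vec_le)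
  also have "\<dots> \<le> ?L * (4 / 3 * lam + mat_norm_inf D * vec_norm1 \<delta>)"
    using L Sigma_delta by simp
  also have "\<dots> = 4 / 3 * (?L * lam) + (?L * mat_norm_inf D) * vec_norm1 \<delta>"
    by (simp add: algebra_simps)
  also have "\<dots> \<le> 4 / 3 * (?L * lam) + lam / 3 * vec_norm1 \<delta>"
    by (intro add_left_mono mult_right_mono D vec_norm1_nonneg)
  finally have inf_le: "vec_norm_inf \<delta> \<le> 4 / 3 * (?L * lam) + lam / 3 * vec_norm1 \<delta>" .

  show ?thesis
  proof (cases "lam = 0")
    \<comment> \<open>The threshold would vanish here, but \<open>inf_le\<close> already forces
      \<open>\<delta>\<close> to be 0.\<close>
    case True
    with inf_le have inf0: "vec_norm_inf \<delta> \<le> 0" by simp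
    then have "vec_norm1 \<delta> = 0"
      by (simp add: vec_norm_inf_le_iff vec_norm1_def)
    with inf0 True show ?thesis by (simp add: \<delta>_def)
  next
    case False
    then have lam: "0 < lam" using lambda(1) by simp
    define t where "t = ?L * lam"
    define n where "n = s * t powr (- q)"
    have t: "0 < t" using L lam by (simp add: t_def)
    have n: "0 \<le> n" using sM by (simp add: n_def)
    \<comment> \<open>This product is exactly the quantity assumed to be at most 1/2.\<close>
    have "lam * n = ?L powr (- q) * lam powr (1 - q) * s"
      using L lam by (simp add: n_def t_def powr_mult powr_diff powr_minus field_simps)
    then have lam_n: "lam * n \<le> 1 / 2" using lambda(3) by simp
    have "lam * (vec_norm1 \<beta>_hat - vec_norm1 \<beta>_star)
        \<le> vec_norm1 \<delta> * vec_norm_inf (\<Sigma>_hat *v \<beta>_star - e)"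
      unfolding \<delta>_def by (rule scio_minimizer_norm1_le[OF Sigma_hat beta_hat])
    also have "\<dots> \<le> vec_norm1 \<delta> * (lam / 3)"
      by (intro mult_left_mono grad_star vec_norm1_nonneg)
    finally have "lam * (3 * (vec_norm1 \<beta>_hat - vec_norm1 \<beta>_star)) \<le> lam * vec_norm1 \<delta>"
      by (simp add: algebra_simps)
    then have "3 * (vec_norm1 (\<beta>_star + \<delta>) - vec_norm1 \<beta>_star) \<le> vec_norm1 \<delta>"
      using lam by (simp add: \<delta>_def)
    then have one_le: "vec_norm1 \<delta> \<le> 3 * n * (vec_norm_inf \<delta> + t)"
      unfolding n_def by (rule norm1_le_of_cone_sparse) (use t q star_sparse in auto)
    \<comment> \<open>Feed the l1 bound back into \<open>inf_le\<close>: half of the sup norm is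
      absorbed on the left, and doubling 4/3 + 1/2 gives 11/3.\<close>
    have "lam / 3 * vec_norm1 \<delta> \<le> lam / 3 * (3 * n * (vec_norm_inf \<delta> + t))"
      using lam one_le by (intro mult_left_mono) auto
    also have "\<dots> = (lam * n) * (vec_norm_inf \<delta> + t)"
      by simp
    also have "\<dots> \<le> 1 / 2 * (vec_norm_inf \<delta> + t)"
      using t vec_norm_inf_nonneg[of \<delta>] by (intro mult_right_mono lam_n) auto
    finally have inf_bound: "vec_norm_inf \<delta> \<le> 11 / 3 * t"
      using inf_le by (simp add: t_def)
    \<comment> \<open>Here 14/3 is 11/3 + 1.\<close>
    have "3 * n * (vec_norm_inf \<delta> + t) \<le> 3 * n * (14 / 3 * t)"
      using n inf_bound by (intro mult_left_mono) auto
    with one_le have one_bound: "vec_norm1 \<delta> \<le> 14 * (n * t)"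
      by simp
    also have "\<dots> \<le> 16 * (n * t)"
      using n t by simp
    also have "n * t = ?L powr (1 - q) * s * lam powr (1 - q)"
      using L lam by (simp add: n_def t_def powr_mult powr_diff powr_minus field_simps)
    finally have "vec_norm1 \<delta> \<le> 16 * ?L powr (1 - q) * s * lam powr (1 - q)"
      by simp
    moreover have "vec_norm_inf \<delta> \<le> 4 * ?L * lam"
      using inf_bound t unfolding t_def by simp
    ultimately show ?thesis unfolding \<delta>_def by blast
  qed
qed

end
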